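(* For any convex set $\mathcal C\subset\mathbb R^d$, $$\mathrm{span}\,\Delta(\mathcal X,\mathcal C)=\mathrm{dir}\big(\mathcal X^\star(\mathcal C)\big).$$
   Context: Let $A\in\mathbb R^{m\times d}$, $b\in\mathbb R^m$, and let $\mathcal X=\{x\in\mathbb R^d: Ax=b,\ x\ge 0\}$, assumed bounded. Let $\mathcal X^\angle$ be the set of extreme points of $\mathcal X$. For $x^\star\in\mathcal X^\angle$: $\mathrm{FD}(x^\star)=\{\delta\in\mathbb R^d:\exists\varepsilon>0,\ x^\star+\varepsilon\delta\in\mathcal X\}$ is the polyhedral cone of feasible directions; $D(x^\star)$ is the set of extreme directions of $\mathrm{FD}(x^\star)$ (nonzero vectors generating extreme rays of this cone); $\Lambda(x^\star)=\{c\in\mathbb R^d: x^\star\in\arg\min_{x\in\mathcal X}c^\top x\}$; and for $\delta\in D(x^\star)$, $F(x^\star,\delta)=\Lambda(x^\star)\cap\{\delta\}^\perp$. Relevant extreme directions: $\Delta(\mathcal X,\mathcal C)=\{\delta\in\mathbb R^d:\exists x^\star\in\mathcal X^\angle,\ \delta\in D(x^\star)\text{ and }F(x^\star,\delta)\cap\mathcal C\ne\varnothing\}$. Reachable solutions: $\mathcal X^\star(\mathcal C)=\bigcup_{c\in\mathcal C}\arg\min_{x\in\mathcal X}c^\top x$. For a set $S\subset\mathbb R^d$, $\mathrm{dir}(S)=\mathrm{span}\{x_1-x_2:x_1,x_2\in S\}$; the span of the empty set is $\{0\}$. *)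

theory Defs
  imports "HOL-Analysis.Analysis"
begin

definition std_polyhedron :: "real^'d^'m \<Rightarrow> real^'m \<Rightarrow> (real^'d) set" where
  "std_polyhedron A b = {x. A *v x = b \<and> (\<forall>i. 0 \<le> x $ i)}"

definition extreme_points :: "(real^'d) set \<Rightarrow> (real^'d) set" where
  "extreme_points X = {x. x extreme_point_of X}"

definition feasible_dirs :: "(real^'d) set \<Rightarrow> real^'d \<Rightarrow> (real^'d) set" where
  "feasible_dirs X xs = {\<delta>. \<exists>\<epsilon>>0. xs + \<epsilon> *\<^sub>R \<delta> \<in> X}"

(* An extreme ray of a convex cone is a half-line from the origin that is a face of the cone. *)
definition extreme_dirs :: "(real^'d) set \<Rightarrow> real^'d \<Rightarrow> (real^'d) set" where
  "extreme_dirs X xs =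
     {\<delta>. \<delta> \<noteq> 0 \<and> {t *\<^sub>R \<delta> | t. 0 \<le> t} face_of feasible_dirs X xs}"

definition lin_argmin :: "(real^'d) set \<Rightarrow> real^'d \<Rightarrow> (real^'d) set" where
  "lin_argmin X c = {x. is_arg_min (\<lambda>y. c \<bullet> y) (\<lambda>y. y \<in> X) x}"

definition optimality_cone :: "(real^'d) set \<Rightarrow> real^'d \<Rightarrow> (real^'d) set" where
  "optimality_cone X xs = {c. xs \<in> lin_argmin X c}"

definition cone_facet :: "(real^'d) set \<Rightarrow> real^'d \<Rightarrow> real^'d \<Rightarrow> (real^'d) set" where
  "cone_facet X xs \<delta> = optimality_cone X xs \<inter> orthogonal_comp {\<delta>}"

definition relevant_dirs :: "(real^'d) set \<Rightarrow> (real^'d) set \<Rightarrow> (real^'d) set" where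
  "relevant_dirs X C =
     {\<delta>. \<exists>xs\<in>extreme_points X. \<delta> \<in> extreme_dirs X xs \<and> cone_facet X xs \<delta> \<inter> C \<noteq> {}}"

definition reachable_solutions :: "(real^'d) set \<Rightarrow> (real^'d) set \<Rightarrow> (real^'d) set" where
  "reachable_solutions X C = (\<Union>c\<in>C. lin_argmin X c)"

definition dir :: "(real^'d) set \<Rightarrow> (real^'d) set" where
  "dir S = span {x - y | x y. x \<in> S \<and> y \<in> S}"

end

theory Submission
  imports Defs
begin

text \<open>Moving from a vertex \<open>v\<close> along a relevant direction stays in the same argmin face, which gives
  one inclusion. Conversely, if \<open>v\<close> is optimal for \<open>c\<close>, the feasible directions at \<open>v\<close> orthogonal
  to \<open>c\<close> form a face of the feasible cone; this face is a closed pointed cone, hence spanned by its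
  extreme rays, and these are extreme rays of the whole feasible cone. So each argmin face lies in a
  single coset of the span \<open>V\<close> of the relevant directions. Since \<open>C\<close> is connected and there are
  finitely many vertices, whose sets of optimal costs are closed, this coset does not depend on the
  cost in \<open>C\<close>.\<close>

section \<open>Extreme rays of pointed cones\<close>

text \<open>If a point of the ray lies strictly between \<open>p\<close> and \<open>q\<close> in
  \<open>K\<close>, then rescaling \<open>p\<close> and \<open>q\<close> to height 1 of the
  functional \<open>a\<close> puts \<open>e\<close> strictly between the rescaled points, unless
  they coincide. Extremality of \<open>e\<close> in the slice therefore forces both rescaled points
  to be \<open>e\<close>.\<close>

lemma ray_face_of_cone:
  fixes K :: "'a::euclidean_space set" and a e :: 'a
  assumes "convex K" and cone: "\<And>x t. x \<in> K \<Longrightarrow> 0 \<le> t \<Longrightarrow> t *\<^sub>R x \<in> K"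
    and pos: "\<And>x. x \<in> K \<Longrightarrow> x \<noteq> 0 \<Longrightarrow> 0 < a \<bullet> x"
    and e: "e extreme_point_of {x \<in> K. a \<bullet> x = 1}"
  shows "{t *\<^sub>R e | t. 0 \<le> t} face_of K"
proof -
  let ?R = "{t *\<^sub>R e | t. 0 \<le> t}"
  have eK: "e \<in> K" and e1: "a \<bullet> e = 1"
    using e by (auto simp: extreme_point_of_def)
  have nonneg: "0 \<le> a \<bullet> x" if "x \<in> K" for x
    using pos[OF that] by (cases "x = 0") auto
  have "convex ?R"
  proof (rule convexI)
    fix x y :: 'a and u v :: real assume "x \<in> ?R" "y \<in> ?R" and uv: "0 \<le> u" "0 \<le> v"
    then obtain s t where "x = s *\<^sub>R e" "y = t *\<^sub>R e" "0 \<le> s" "0 \<le> t" by blast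
    then have "u *\<^sub>R x + v *\<^sub>R y = (u * s + v * t) *\<^sub>R e \<and> 0 \<le> u * s + v * t"
      using uv by (simp add: scaleR_add_left)
    then show "u *\<^sub>R x + v *\<^sub>R y \<in> ?R" by blast
  qed
  moreover have "p \<in> ?R \<and> q \<in> ?R"
    if p: "p \<in> K" and q: "q \<in> K" and x: "x \<in> ?R" "x \<in> open_segment p q" for p q x
  proof -
    obtain s where s: "x = s *\<^sub>R e" "0 \<le> s" using x by blast
    obtain u where u: "0 < u" "u < 1" and xu: "x = (1 - u) *\<^sub>R p + u *\<^sub>R q"
      using x(2) by (auto simp: in_segment)
    have "p \<noteq> q" using x(2) by auto
    define \<alpha> \<beta> where "\<alpha> = a \<bullet> p" and "\<beta> = a \<bullet> q"
    have s_eq: "s = (1 - u) * \<alpha> + u * \<beta>"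
      using arg_cong[OF xu, of "\<lambda>y. a \<bullet> y"] s e1 by (simp add: inner_add_right \<alpha>_def \<beta>_def)
    \<comment> \<open>Height 0 occurs only at the apex, which cannot be rescaled to the slice. An
      endpoint at the apex is treated separately: the other one is then a multiple of
      \<open>e\<close>.\<close>
    consider "\<alpha> = 0" | "\<beta> = 0" | "\<alpha> > 0" "\<beta> > 0"
      using nonneg[OF p] nonneg[OF q] unfolding \<alpha>_def \<beta>_def by linarith
    then show ?thesis
    proof cases
      case 1
      then have "p = 0" using pos[OF p] by (auto simp: \<alpha>_def)
      then have "u *\<^sub>R q = s *\<^sub>R e" using s xu by simp
      then have "inverse u *\<^sub>R u *\<^sub>R q = inverse u *\<^sub>R s *\<^sub>R e" by simp
      then have "q = (s / u) *\<^sub>R e" using u by (simp add: divide_inverse mult.commute)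
      moreover have "p = 0 *\<^sub>R e" using \<open>p = 0\<close> by simp
      moreover have "0 \<le> s / u" using s u by simp
      ultimately show ?thesis by blast
    next
      case 2
      then have "q = 0" using pos[OF q] by (auto simp: \<beta>_def)
      then have "(1 - u) *\<^sub>R p = s *\<^sub>R e" using s xu by simp
      then have "inverse (1 - u) *\<^sub>R (1 - u) *\<^sub>R p = inverse (1 - u) *\<^sub>R s *\<^sub>R e" by simp
      then have "p = (s / (1 - u)) *\<^sub>R e" using u by (simp add: divide_inverse mult.commute)
      moreover have "q = 0 *\<^sub>R e" using \<open>q = 0\<close> by simp
      moreover have "0 \<le> s / (1 - u)" using s u by simp
      ultimately show ?thesis by blast
    next
      case 3
      let ?p = "inverse \<alpha> *\<^sub>R p" and ?q = "inverse \<beta> *\<^sub>R q"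
      have pq: "?p \<in> {x \<in> K. a \<bullet> x = 1}" "?q \<in> {x \<in> K. a \<bullet> x = 1}"
        using 3 p q by (auto intro!: cone simp: \<alpha>_def \<beta>_def)
      have "s > 0" unfolding s_eq using 3 u by (intro add_pos_pos mult_pos_pos) auto
      \<comment> \<open>Dividing \<open>xu\<close> by the height \<open>s\<close> of
        \<open>x\<close> turns the term in \<open>q\<close> into
        \<open>(u * \<beta> / s) *\<^sub>R ?q\<close>, so \<open>w\<close> is the weight of
        \<open>?q\<close> in the resulting convex combination.\<close>
      define w where "w = u * \<beta> / s"
      have w: "0 < w" "1 - w = (1 - u) * \<alpha> / s" "w < 1"
      proof -
        show "0 < w" using u 3 \<open>s > 0\<close> by (simp add: w_def)
        show w1: "1 - w = (1 - u) * \<alpha> / s" using \<open>s > 0\<close> s_eq by (simp add: w_def field_simps)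
        have "0 < (1 - u) * \<alpha> / s" using u 3 \<open>s > 0\<close> by simp
        with w1 show "w < 1" by linarith
      qed
      have "e = inverse s *\<^sub>R x" using s \<open>s > 0\<close> by simp
      also have "\<dots> = (1 - w) *\<^sub>R ?p + w *\<^sub>R ?q"
      proof -
        have "(1 - w) * inverse \<alpha> = inverse s * (1 - u)" "w * inverse \<beta> = inverse s * u"
          unfolding w(2) unfolding w_def using 3 \<open>s > 0\<close> by (simp_all add: field_simps)
        then show ?thesis by (simp only: xu scaleR_add_right scaleR_scaleR)
      qed
      finally have ew: "e = (1 - w) *\<^sub>R ?p + w *\<^sub>R ?q" .
      have "?p = ?q"
        using e pq ew w unfolding extreme_point_of_def in_segment by blast
      moreover from this have "?q = e" using ew by (metis scaleR_collapse)
      ultimately have "?p = e" "?q = e" by simp_all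
      then have "\<alpha> *\<^sub>R ?p = \<alpha> *\<^sub>R e" "\<beta> *\<^sub>R ?q = \<beta> *\<^sub>R e" by simp_all
      then have "p = \<alpha> *\<^sub>R e" "q = \<beta> *\<^sub>R e" using 3 by simp_all
      then show ?thesis using 3 less_imp_le by blast
    qed
  qed
  ultimately show ?thesis
    unfolding face_of_def using cone[OF eK] by blast
qed

text \<open>The slice of the cone at height 1 of the functional is compact, so Krein--Milman applies to it.\<close>

lemma cone_subset_span_extreme_rays:
  fixes K :: "'a::euclidean_space set" and a :: 'a
  assumes "closed K" "convex K" and cone: "\<And>x t. x \<in> K \<Longrightarrow> 0 \<le> t \<Longrightarrow> t *\<^sub>R x \<in> K"
    and pos: "\<And>x. x \<in> K \<Longrightarrow> x \<noteq> 0 \<Longrightarrow> 0 < a \<bullet> x"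
  shows "K \<subseteq> span {\<delta>. \<delta> \<noteq> 0 \<and> {t *\<^sub>R \<delta> | t. 0 \<le> t} face_of K}"
proof
  fix x assume x: "x \<in> K"
  let ?D = "{\<delta>. \<delta> \<noteq> 0 \<and> {t *\<^sub>R \<delta> | t. 0 \<le> t} face_of K}"
  let ?B = "{x \<in> K. a \<bullet> x = 1}"
  show "x \<in> span ?D"
  proof (cases "x = 0")
    case True
    then show ?thesis by (simp add: span_zero)
  next
    case False
    have unit: "inverse (norm y) *\<^sub>R y \<in> K \<inter> sphere 0 1" if "y \<in> K" "y \<noteq> 0" for y
      using that cone by auto
    \<comment> \<open>The minimum of \<open>a\<close> over the unit vectors of \<open>K\<close> is
      attained, hence positive. Its reciprocal bounds the norm on the slice
      \<open>?B\<close>.\<close>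
    have "compact (K \<inter> sphere 0 1)"
      using \<open>closed K\<close> by (simp add: closed_Int_compact)
    moreover have "K \<inter> sphere 0 1 \<noteq> {}"
      using unit[OF x False] by blast
    ultimately obtain z where z: "z \<in> K \<inter> sphere 0 1"
      and min: "\<And>y. y \<in> K \<inter> sphere 0 1 \<Longrightarrow> a \<bullet> z \<le> a \<bullet> y"
      using continuous_attains_inf[of "K \<inter> sphere 0 1" "\<lambda>y. a \<bullet> y"]
        continuous_on_inner[OF continuous_on_const continuous_on_id]
      by blast
    have az: "0 < a \<bullet> z" using pos z by force
    have "bounded ?B"
    proof (rule boundedI)
      fix y assume y: "y \<in> ?B"
      then have "y \<noteq> 0" by auto
      then have "a \<bullet> z \<le> a \<bullet> (inverse (norm y) *\<^sub>R y)" using y unit min by blast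
      then have "a \<bullet> z \<le> inverse (norm y)" using y by simp
      then show "norm y \<le> inverse (a \<bullet> z)"
        using az by (metis inverse_inverse_eq le_imp_inverse_le)
    qed
    moreover have "closed ?B"
      using closed_Int[OF \<open>closed K\<close> closed_hyperplane[of a 1]] by (simp add: Int_def)
    moreover have "convex ?B"
      using convex_Int[OF \<open>convex K\<close> convex_hyperplane[of a 1]] by (simp add: Int_def)
    ultimately have B: "?B = convex hull {e. e extreme_point_of ?B}"
      by (intro Krein_Milman_Minkowski) (auto simp: compact_eq_bounded_closed)
    have "{e. e extreme_point_of ?B} \<subseteq> ?D"
      using ray_face_of_cone[OF \<open>convex K\<close> cone pos] by (auto simp: extreme_point_of_def)
    then have "?B \<subseteq> span ?D"
      using B by (metis (no_types, lifting) convex_hull_subset_span order_trans span_mono)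
    moreover have "inverse (a \<bullet> x) *\<^sub>R x \<in> ?B"
      using pos[OF x False] x cone by auto
    ultimately have "(a \<bullet> x) *\<^sub>R inverse (a \<bullet> x) *\<^sub>R x \<in> span ?D"
      by (blast intro: span_scale)
    then show ?thesis using pos[OF x False] by simp
  qed
qed

section \<open>Argmin sets as faces\<close>

lemma lin_argmin_iff: "x \<in> lin_argmin X c \<longleftrightarrow> x \<in> X \<and> (\<forall>y\<in>X. c \<bullet> x \<le> c \<bullet> y)"
  unfolding lin_argmin_def is_arg_min_def by (auto simp: not_less)

lemma lin_argmin_eq:
  assumes "v \<in> lin_argmin X c"
  shows "lin_argmin X c = X \<inter> {x. c \<bullet> x = c \<bullet> v}"
  using assms by (force simp: lin_argmin_iff)

lemma lin_argmin_face_of: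
  assumes "convex X"
  shows "lin_argmin X c face_of X"
proof (cases "lin_argmin X c = {}")
  case False
  then obtain v where v: "v \<in> lin_argmin X c" by blast
  then show ?thesis
    unfolding lin_argmin_eq[OF v] using assms v
    by (intro face_of_Int_supporting_hyperplane_ge) (auto simp: lin_argmin_iff)
qed simp

text \<open>The argmin is a nonempty compact face, so it has an extreme point, and an extreme point
  of a face is extreme in the whole set.\<close>

lemma lin_argmin_extreme_point:
  fixes X :: "(real^'d) set"
  assumes "compact X" "convex X" "X \<noteq> {}"
  obtains v where "v \<in> extreme_points X" "v \<in> lin_argmin X c"
proof -
  have "continuous_on X (\<lambda>y. c \<bullet> y)" by (intro continuous_intros)
  then obtain x where "x \<in> lin_argmin X c"
    using continuous_attains_inf[OF assms(1,3)] by (auto simp: lin_argmin_iff)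
  moreover have face: "lin_argmin X c face_of X" using assms(2) by (rule lin_argmin_face_of)
  ultimately obtain v where "v extreme_point_of lin_argmin X c"
    using extreme_point_exists_convex[of "lin_argmin X c"] assms
    by (metis empty_iff face_of_imp_compact face_of_imp_convex)
  then have "v extreme_point_of X" "v \<in> lin_argmin X c"
    using extreme_point_of_face[OF face] by auto
  then show thesis using that by (simp add: extreme_points_def)
qed

section \<open>Feasible cones of a standard-form polyhedron\<close>

text \<open>This supplies closedness and convexity of the feasible set and the finiteness of its
  vertex set.\<close>

lemma polyhedron_std_polyhedron: "polyhedron (std_polyhedron A b)"
proof -
  have "std_polyhedron A b =
      (\<Inter>i. {x. row i A \<bullet> x = b $ i}) \<inter> (\<Inter>i. {x. axis i 1 \<bullet> x \<ge> 0})"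
    by (auto simp: std_polyhedron_def vec_eq_iff matrix_vector_mul_component row_def inner_axis' 
        vec_lambda_eta)
  then show ?thesis
    by (auto intro!: polyhedron_Int polyhedron_Inter polyhedron_hyperplane polyhedron_halfspace_ge)
qed

text \<open>Coordinates that are positive at \<open>v\<close> stay positive for small steps, so
  among the sign constraints only the tight ones restrict a direction. The right-hand side makes
  convexity, closedness and invariance under scaling visible, which the existential step length
  hides.\<close>

lemma feasible_dirs_std_polyhedron:
  assumes v: "v \<in> std_polyhedron A b"
  shows "feasible_dirs (std_polyhedron A b) v = {\<delta>. A *v \<delta> = 0 \<and> (\<forall>i. v $ i = 0 \<longrightarrow> 0 \<le> \<delta> $ i)}"
    (is "?L = ?R")
proof
  show "?L \<subseteq> ?R"
  proof
    fix \<delta> assume "\<delta> \<in> ?L"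
    then obtain \<epsilon> where \<epsilon>: "0 < \<epsilon>" "v + \<epsilon> *\<^sub>R \<delta> \<in> std_polyhedron A b"
      by (auto simp: feasible_dirs_def)
    then have "A *v \<delta> = 0"
      using v by (simp add: std_polyhedron_def matrix_vector_right_distrib matrix_vector_mult_scaleR)
    moreover have "0 \<le> \<delta> $ i" if "v $ i = 0" for i
    proof -
      have "0 \<le> (v + \<epsilon> *\<^sub>R \<delta>) $ i" using \<epsilon>(2) by (simp add: std_polyhedron_def)
      then show ?thesis using \<epsilon>(1) that by (simp add: zero_le_mult_iff)
    qed
    ultimately show "\<delta> \<in> ?R" by simp
  qed
next
  show "?R \<subseteq> ?L"
  proof
    fix \<delta> assume \<delta>: "\<delta> \<in> ?R"
    \<comment> \<open>Each coordinate admits all small enough positive steps. Phrased with a filter,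
      the finitely many thresholds combine into a common step.\<close>
    have "\<forall>\<^sub>F \<epsilon> in at_right (0::real). 0 \<le> v $ i + \<epsilon> * \<delta> $ i" for i
    proof (cases "v $ i = 0")
      case True
      then show ?thesis using \<delta> by (auto simp: eventually_at_filter)
    next
      case False
      then have "0 < v $ i" using v by (simp add: std_polyhedron_def less_le)
      moreover have "((\<lambda>\<epsilon>. v $ i + \<epsilon> * \<delta> $ i) \<longlongrightarrow> v $ i + 0 * \<delta> $ i) (at_right 0)"
        by (intro tendsto_intros)
      ultimately have "\<forall>\<^sub>F \<epsilon> in at_right (0::real). 0 < v $ i + \<epsilon> * \<delta> $ i"
        by (intro order_tendstoD) auto
      then show ?thesis by (rule eventually_mono) simp
    qed
    then have "\<forall>\<^sub>F \<epsilon> in at_right (0::real). \<forall>i. 0 \<le> v $ i + \<epsilon> * \<delta> $ i"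
      by (rule eventually_all_finite)
    then have "\<forall>\<^sub>F \<epsilon> in at_right (0::real). 0 < \<epsilon> \<and> (\<forall>i. 0 \<le> v $ i + \<epsilon> * \<delta> $ i)"
      using eventually_at_right_less[of "0::real"] by eventually_elim simp
    then obtain \<epsilon> :: real where "0 < \<epsilon>" "\<forall>i. 0 \<le> v $ i + \<epsilon> * \<delta> $ i"
      using eventually_happens trivial_limit_at_right_real by blast
    then show "\<delta> \<in> ?L"
      using v \<delta> by (auto simp: feasible_dirs_def std_polyhedron_def matrix_vector_right_distrib
        matrix_vector_mult_scaleR)
  qed
qed

lemma lin_argmin_diff_in_span:
  fixes A :: "real^'d^'m" and b :: "real^'m"
  defines "X \<equiv> std_polyhedron A b"
  assumes v: "v \<in> extreme_points X" "v \<in> lin_argmin X c" and w: "w \<in> lin_argmin X c"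
  shows "w - v \<in> span {\<delta> \<in> extreme_dirs X v. c \<bullet> \<delta> = 0}"
proof -
  have vX: "v \<in> X" using v(2) by (simp add: lin_argmin_iff)
  let ?F = "feasible_dirs X v"
  let ?K = "?F \<inter> {\<delta>. c \<bullet> \<delta> = 0}"
  \<comment> \<open>This functional certifies that the feasible cone is pointed: it sums the
    coordinates that are tight at \<open>v\<close>, all nonnegative on the cone. If the sum is 0,
    then \<open>\<delta>\<close> and \<open>- \<delta>\<close> are both feasible, and extremality of
    \<open>v\<close> gives \<open>\<delta> = 0\<close>.\<close>
  define a :: "real^'d" where "a = (\<chi> i. if v $ i = 0 then 1 else 0)"
  note F = feasible_dirs_std_polyhedron[OF vX[unfolded X_def], folded X_def]
  have a_inner: "a \<bullet> \<delta> = (\<Sum>i | v $ i = 0. \<delta> $ i)" for \<delta>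
    by (simp add: inner_vec_def a_def if_distrib[of "\<lambda>t. t * _"] sum.If_cases cong: if_cong)
  have pos: "0 < a \<bullet> \<delta>" if \<delta>: "\<delta> \<in> ?F" "\<delta> \<noteq> 0" for \<delta>
  proof (rule ccontr)
    assume "\<not> 0 < a \<bullet> \<delta>"
    moreover have nn: "\<forall>i. v $ i = 0 \<longrightarrow> 0 \<le> \<delta> $ i" using \<delta> F by auto
    ultimately have "(\<Sum>i | v $ i = 0. \<delta> $ i) = 0"
      unfolding a_inner by (intro antisym) (auto intro: sum_nonneg)
    then have "\<forall>i. v $ i = 0 \<longrightarrow> \<delta> $ i = 0"
      using nn by (subst (asm) sum_nonneg_eq_0_iff) auto
    \<comment> \<open>Otherwise \<open>v\<close> would lie inside a segment of \<open>X\<close> in direction \<open>\<delta>\<close>.\<close>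
    then have "- \<delta> \<in> ?F"
      using \<delta> F by (simp add: vec.neg)
    then obtain \<epsilon>1 \<epsilon>2 where \<epsilon>: "\<epsilon>1 > 0" "v + \<epsilon>1 *\<^sub>R \<delta> \<in> X" "\<epsilon>2 > 0" "v + \<epsilon>2 *\<^sub>R (- \<delta>) \<in> X"
      using \<delta> unfolding feasible_dirs_def by blast
    \<comment> \<open>The weight is chosen so that the displacements \<open>\<epsilon>1\<close>
      along \<open>\<delta>\<close> and \<open>\<epsilon>2\<close> along \<open>- \<delta>\<close>
      cancel.\<close>
    define u where "u = \<epsilon>1 / (\<epsilon>1 + \<epsilon>2)"
    have "(1 - u) * \<epsilon>1 - u * \<epsilon>2 = 0" using \<epsilon> by (simp add: u_def field_simps)
    moreover have "(1 - u) *\<^sub>R (v + \<epsilon>1 *\<^sub>R \<delta>) + u *\<^sub>R (v + \<epsilon>2 *\<^sub>R (- \<delta>))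
        = v + ((1 - u) * \<epsilon>1 - u * \<epsilon>2) *\<^sub>R \<delta>"
      by (simp add: algebra_simps)
    ultimately have "v = (1 - u) *\<^sub>R (v + \<epsilon>1 *\<^sub>R \<delta>) + u *\<^sub>R (v + \<epsilon>2 *\<^sub>R (- \<delta>))"
      by simp
    moreover have "0 < u" "u < 1" using \<epsilon> by (auto simp: u_def field_simps)
    moreover have "v + \<epsilon>1 *\<^sub>R \<delta> \<noteq> v + \<epsilon>2 *\<^sub>R (- \<delta>)"
    proof
      assume "v + \<epsilon>1 *\<^sub>R \<delta> = v + \<epsilon>2 *\<^sub>R (- \<delta>)"
      then have "(\<epsilon>1 + \<epsilon>2) *\<^sub>R \<delta> = 0" by (simp add: scaleR_add_left)
      then show False using \<epsilon> \<delta> by simp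
    qed
    ultimately have "v \<in> open_segment (v + \<epsilon>1 *\<^sub>R \<delta>) (v + \<epsilon>2 *\<^sub>R (- \<delta>))"
      unfolding in_segment by blast
    then show False
      using v(1) \<epsilon> by (auto simp: extreme_points_def extreme_point_of_def)
  qed
  have cF: "convex ?F"
    unfolding F by (auto intro!: convexI simp: matrix_vector_right_distrib matrix_vector_mult_scaleR)
  \<comment> \<open>Optimality of \<open>v\<close> makes \<open>c\<close> nonnegative on the
    feasible cone, so its zero set is a supporting hyperplane and cuts out a face.\<close>
  have F_inner: "0 \<le> c \<bullet> \<delta>" if \<delta>: "\<delta> \<in> ?F" for \<delta>
  proof -
    obtain \<epsilon> where "0 < \<epsilon>" "v + \<epsilon> *\<^sub>R \<delta> \<in> X" using \<delta> by (auto simp: feasible_dirs_def)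
    then have "c \<bullet> v \<le> c \<bullet> (v + \<epsilon> *\<^sub>R \<delta>)" using v(2) by (simp add: lin_argmin_iff)
    then show ?thesis using \<open>0 < \<epsilon>\<close> by (simp add: inner_add_right zero_le_mult_iff)
  qed
  have face: "?K face_of ?F"
    using cF F_inner by (rule face_of_Int_supporting_hyperplane_ge)
  have "?F = {\<delta>. A *v \<delta> = 0} \<inter> (\<Inter>i\<in>{i. v $ i = 0}. {\<delta>. 0 \<le> \<delta> $ i})"
    unfolding F by auto
  moreover have "closed \<dots>"
    by (intro closed_Int closed_INT ballI closed_Collect_eq closed_Collect_le continuous_intros
        linear_continuous_on matrix_vector_mul_bounded_linear)
  ultimately have "closed ?K"
    by (auto intro: closed_Int closed_hyperplane)
  moreover have "convex ?K"
    using cF by (intro convex_Int convex_hyperplane)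
  moreover have "t *\<^sub>R \<delta> \<in> ?K" if "\<delta> \<in> ?K" "0 \<le> t" for t \<delta>
    using that unfolding F by (simp add: matrix_vector_mult_scaleR)
  ultimately have K: "?K \<subseteq> span {\<delta>. \<delta> \<noteq> 0 \<and> {t *\<^sub>R \<delta> | t. 0 \<le> t} face_of ?K}"
    using pos by (intro cone_subset_span_extreme_rays[of _ a]) auto
  have "{\<delta>. \<delta> \<noteq> 0 \<and> {t *\<^sub>R \<delta> | t. 0 \<le> t} face_of ?K} \<subseteq> {\<delta> \<in> extreme_dirs X v. c \<bullet> \<delta> = 0}"
  proof
    fix \<delta> assume \<delta>: "\<delta> \<in> {\<delta>. \<delta> \<noteq> 0 \<and> {t *\<^sub>R \<delta> | t. 0 \<le> t} face_of ?K}"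
    \<comment> \<open>The vector lies on its own ray, hence in \<open>?K\<close>, which gives
      orthogonality to \<open>c\<close>; transitivity of faces then makes the ray extreme in the
      full feasible cone.\<close>
    have "1 *\<^sub>R \<delta> \<in> {t *\<^sub>R \<delta> | t. 0 \<le> t}" using zero_le_one by blast
    then have "\<delta> \<in> ?K" using \<delta> by (auto dest!: face_of_imp_subset)
    then show "\<delta> \<in> {\<delta> \<in> extreme_dirs X v. c \<bullet> \<delta> = 0}"
      using \<delta> face face_of_trans by (auto simp: extreme_dirs_def)
  qed
  moreover have "w - v \<in> ?K"
  proof -
    have "v + 1 *\<^sub>R (w - v) \<in> X" using w by (simp add: lin_argmin_iff)
    then have "w - v \<in> ?F" unfolding feasible_dirs_def using zero_less_one by blast
    moreover have "c \<bullet> w = c \<bullet> v" using w lin_argmin_eq[OF v(2)] by blast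
    ultimately show ?thesis by (simp add: inner_diff_right)
  qed
  ultimately show ?thesis using K span_mono by blast
qed

section \<open>Passing from one cost to another by connectedness\<close>

text \<open>The subspace is abstract here: \<open>opt\<close> places each argmin face, for a single
  cost in \<open>C\<close>, in one coset of \<open>V\<close>. Connectedness of \<open>C\<close>
  makes this coset the same for all costs.\<close>

lemma lin_argmin_diff_in_subspace:
  fixes X C V :: "(real^'d) set"
  assumes X: "compact X" "convex X" "finite (extreme_points X)" and "convex C" and "subspace V"
    and opt: "\<And>c v w. \<lbrakk>c \<in> C; v \<in> extreme_points X; v \<in> lin_argmin X c; w \<in> lin_argmin X c\<rbrakk>
      \<Longrightarrow> w - v \<in> V"
    and x: "c1 \<in> C" "x \<in> lin_argmin X c1" and y: "c2 \<in> C" "y \<in> lin_argmin X c2"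
  shows "x - y \<in> V"
proof -
  have "X \<noteq> {}" using x by (auto simp: lin_argmin_iff)
  obtain v1 where v1: "v1 \<in> extreme_points X" "v1 \<in> lin_argmin X c1"
    using lin_argmin_extreme_point[OF X(1,2) \<open>X \<noteq> {}\<close>] .
  obtain v2 where v2: "v2 \<in> extreme_points X" "v2 \<in> lin_argmin X c2"
    using lin_argmin_extreme_point[OF X(1,2) \<open>X \<noteq> {}\<close>] .
  let ?E = "extreme_points X"
  \<comment> \<open>\<open>S\<close> collects the costs with an optimal vertex in the coset of
    \<open>v1\<close>, \<open>T\<close> those with an optimal vertex outside it. A cost of
    \<open>C\<close> in both would have two optimal vertices in different cosets, against
    \<open>opt\<close>; so \<open>S\<close> and \<open>T\<close> would separate \<open>C\<close> if
    \<open>c2\<close> were in \<open>T\<close>.\<close>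
  define S T where "S = (\<Union>v\<in>{v\<in>?E. v - v1 \<in> V}. optimality_cone X v)"
    and "T = (\<Union>v\<in>{v\<in>?E. v - v1 \<notin> V}. optimality_cone X v)"
  have cl: "closed (optimality_cone X v)" if "v \<in> ?E" for v
  proof -
    have "v \<in> X" using that by (simp add: extreme_points_def extreme_point_of_def)
    \<comment> \<open>For \<open>v\<close> in \<open>X\<close>, optimality amounts to weak
      inequalities linear in the cost, one for each competitor, so the cone is an intersection of
      closed sets.\<close>
    then have "optimality_cone X v = (\<Inter>y\<in>X. {c. c \<bullet> v \<le> c \<bullet> y})"
      by (auto simp: optimality_cone_def lin_argmin_iff)
    then show ?thesis
      by (auto intro!: closed_INT closed_Collect_le continuous_intros)
  qed
  have "v2 - v1 \<in> V"
  proof (rule ccontr)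
    assume "v2 - v1 \<notin> V"
    then have "c2 \<in> T" using v2 by (auto simp: T_def optimality_cone_def)
    moreover have "c1 \<in> S"
      using v1 \<open>subspace V\<close> by (auto simp: S_def optimality_cone_def subspace_0 intro!: bexI[of _ v1])
    moreover have "closed S" "closed T"
      using cl X(3) by (auto simp: S_def T_def intro!: closed_UN)
    moreover have "C \<subseteq> S \<union> T"
    proof
      fix c
      obtain v where "v \<in> ?E" "v \<in> lin_argmin X c"
        using lin_argmin_extreme_point[OF X(1,2) \<open>X \<noteq> {}\<close>] .
      then show "c \<in> S \<union> T" by (auto simp: S_def T_def optimality_cone_def)
    qed
    moreover have "S \<inter> T \<inter> C = {}"
    proof (rule ccontr)
      assume "S \<inter> T \<inter> C \<noteq> {}"
      then obtain c v w where "c \<in> C" "v \<in> ?E" "v - v1 \<in> V" "v \<in> lin_argmin X c"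
        "w \<in> ?E" "w - v1 \<notin> V" "w \<in> lin_argmin X c"
        by (auto simp: S_def T_def optimality_cone_def)
      moreover from this have "w - v \<in> V" using opt by blast
      ultimately show False
        using subspace_add[OF \<open>subspace V\<close>, of "w - v" "v - v1"] by simp
    qed
    ultimately show False
      using convex_connected[OF \<open>convex C\<close>] x(1) y(1) unfolding connected_closed by blast
  qed
  moreover have "x - v1 \<in> V" "y - v2 \<in> V" using opt v1 v2 x y by blast+
  ultimately have "(x - v1) - (y - v2) - (v2 - v1) \<in> V"
    using \<open>subspace V\<close> by (meson subspace_diff)
  then show ?thesis by simp
qed

section \<open>The two inclusions\<close>

theorem theorem2:
  fixes A :: "real^'d^'m" and b :: "real^'m" and C :: "(real^'d) set"
  assumes "bounded (std_polyhedron A b)"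
    and "convex C"
  shows "span (relevant_dirs (std_polyhedron A b) C)
    = dir (reachable_solutions (std_polyhedron A b) C)"
proof
  let ?X = "std_polyhedron A b"
  let ?R = "reachable_solutions ?X C"
  show "span (relevant_dirs ?X C) \<subseteq> dir ?R"
    unfolding dir_def
  proof (rule span_minimal[OF _ subspace_span], rule subsetI)
    fix \<delta> assume "\<delta> \<in> relevant_dirs ?X C"
    then obtain v c where \<delta>: "\<delta> \<in> extreme_dirs ?X v" and c: "c \<in> C" "v \<in> lin_argmin ?X c"
      and ortho: "c \<bullet> \<delta> = 0"
      by (auto simp: relevant_dirs_def cone_facet_def optimality_cone_def orthogonal_comp_def
          orthogonal_def inner_commute)
    have "1 *\<^sub>R \<delta> \<in> {t *\<^sub>R \<delta> | t. 0 \<le> t}" using zero_le_one by blast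
    then have "\<delta> \<in> feasible_dirs ?X v"
      using \<delta> by (auto simp: extreme_dirs_def dest!: face_of_imp_subset)
    then obtain \<epsilon> where \<epsilon>: "\<epsilon> > 0" "v + \<epsilon> *\<^sub>R \<delta> \<in> ?X" by (auto simp: feasible_dirs_def)
    \<comment> \<open>The step is orthogonal to \<open>c\<close>, so the new feasible point has the
      same cost as the optimal \<open>v\<close>. Both points are thus reachable, and their
      difference is a positive multiple of \<open>\<delta>\<close>.\<close>
    then have "v + \<epsilon> *\<^sub>R \<delta> \<in> lin_argmin ?X c"
      unfolding lin_argmin_eq[OF c(2)] using ortho by (simp add: inner_add_right)
    then have "(v + \<epsilon> *\<^sub>R \<delta>) - v \<in> {x - y | x y. x \<in> ?R \<and> y \<in> ?R}"
      using c unfolding reachable_solutions_def by blast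
    then have "inverse \<epsilon> *\<^sub>R ((v + \<epsilon> *\<^sub>R \<delta>) - v) \<in> span {x - y | x y. x \<in> ?R \<and> y \<in> ?R}"
      by (intro span_scale span_base)
    then show "\<delta> \<in> span {x - y | x y. x \<in> ?R \<and> y \<in> ?R}" using \<epsilon>(1) by simp
  qed
  have "polyhedron ?X" by (rule polyhedron_std_polyhedron)
  then have X: "compact ?X" "convex ?X" "finite (extreme_points ?X)"
    using assms(1) by (auto simp: compact_eq_bounded_closed polyhedron_imp_closed
        polyhedron_imp_convex extreme_points_def finite_polyhedron_extreme_points)
  have opt: "w - v \<in> span (relevant_dirs ?X C)"
    if "c \<in> C" "v \<in> extreme_points ?X" "v \<in> lin_argmin ?X c" "w \<in> lin_argmin ?X c" for c v w
  proof -
    \<comment> \<open>The cost \<open>c\<close> itself witnesses that the facet belonging to such a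
      direction meets \<open>C\<close>.\<close>
    have "{\<delta> \<in> extreme_dirs ?X v. c \<bullet> \<delta> = 0} \<subseteq> relevant_dirs ?X C"
      using that by (auto simp: relevant_dirs_def cone_facet_def optimality_cone_def
          orthogonal_comp_def orthogonal_def inner_commute)
    then show ?thesis
      using lin_argmin_diff_in_span[OF that(2-4)] span_mono by blast
  qed
  show "dir ?R \<subseteq> span (relevant_dirs ?X C)"
    unfolding dir_def
  proof (rule span_minimal[OF _ subspace_span], rule subsetI)
    fix z assume "z \<in> {x - y | x y. x \<in> ?R \<and> y \<in> ?R}"
    then obtain x y c1 c2 where z: "z = x - y" and xy: "c1 \<in> C" "x \<in> lin_argmin ?X c1"
      "c2 \<in> C" "y \<in> lin_argmin ?X c2"
      by (auto simp: reachable_solutions_def)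
    show "z \<in> span (relevant_dirs ?X C)"
      unfolding z by (rule lin_argmin_diff_in_subspace[OF X assms(2) subspace_span opt xy])
  qed
qed

end
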